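(* For every complex number $q$ with $0<|q|<1$, \[ \sum_{k=1}^{\infty}q^{2k^2+2k}[8k-1]\frac{(q^2;q^2)_{k}^2(q^{-3};q^2)_{2k}}{(q^4;q^2)_{2k}(q^3;q^6)_{k}^2}\sum_{i=1}^{k}\left\{\frac{q^{6i-3}}{[6i-3]^2}-\frac{q^{2i}}{[2i]^2}\right\} =\frac{(q;q^2)_{\infty}(q^6;q^6)_{\infty}^3}{(q^4;q^2)_{\infty}(q^3;q^6)_{\infty}^3}\sum_{j=1}^{\infty}(-1)^{j}\frac{q^{3j-1}}{[3j]^2}. \]
   Context: For complex $x,q$ with $|q|<1$: $(x;q)_\infty=\prod_{i\ge 0}(1-xq^i)$ and, for an integer $n\ge 0$, $(x;q)_n=\prod_{i=0}^{n-1}(1-xq^i)$. Multiple arguments mean products: $(x_1,\dots,x_r;q)_m=(x_1;q)_m\cdots(x_r;q)_m$. The $q$-integer is $[n]=1+q+\cdots+q^{n-1}=(1-q^n)/(1-q)$. *)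

theory Defs
  imports "HOL-Analysis.Analysis"
begin

definition qpoch :: "complex \<Rightarrow> complex \<Rightarrow> nat \<Rightarrow> complex" where
  "qpoch x q n = (\<Prod>i<n. 1 - x * q ^ i)"

definition qpochinf :: "complex \<Rightarrow> complex \<Rightarrow> complex" where
  "qpochinf x q = (\<Prod>i. 1 - x * q ^ i)"

definition qint :: "complex \<Rightarrow> nat \<Rightarrow> complex" where
  "qint q n = (1 - q ^ n) / (1 - q)"

end

theory Submission
  imports Defs "HOL-Complex_Analysis.Complex_Analysis"
begin

text \<open>
  Write \<open>p = q\<^sup>2\<close>. The identity is the first-order coefficient at \<open>u = 0\<close> of an identity between
  functions of \<open>u\<close>, obtained by replacing every squared factor \<open>(1 - y)\<^sup>2\<close> by
  \<open>(1 - x * y) * (1 - y / x) = (1 - y)\<^sup>2 - y * u\<close> with \<open>u = x + 1/x - 2\<close>. For a further parameter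
  \<open>a\<close> (the theorem is the case \<open>a = 1/q\<close>) the deformed series \<open>S a u\<close> satisfies
  \<open>sqfac (a * p\<^sup>2) u * S a u = (1 - a) * (1 - a * p) * S (a * p^3) u\<close>, by creative telescoping.
  Iterating expresses \<open>S a u\<close> as an infinite product times \<open>S 0 u\<close>. Since the series with \<open>a = p\<close>
  collapses to \<open>1 - p\<close>, this determines \<open>S 0 u\<close> and hence \<open>S a u\<close> in closed form. All limits are
  locally uniform in \<open>u\<close>, so both sides can be differentiated at \<open>u = 0\<close>.
\<close>

section \<open>The deformed summand and its certificate\<close>

definition sqfac :: "complex \<Rightarrow> complex \<Rightarrow> complex" where
  "sqfac y u = (1 - y)\<^sup>2 - y * u"

text \<open>For \<open>p = q^2\<close>, \<open>a = 1/q\<close>, \<open>u = 0\<close> and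
  \<open>k > 0\<close> this is \<open>1 - q\<close> times the coefficient of the inner sum in the
  theorem. Only the product over \<open>i\<close> depends on \<open>u\<close>.\<close>

definition cubic_term :: "complex \<Rightarrow> complex \<Rightarrow> complex \<Rightarrow> nat \<Rightarrow> complex" where
  "cubic_term p a u k = p ^ (k\<^sup>2 + k) * (1 - a * p ^ (4*k)) * qpoch (a / p) p (2*k)
     * (\<Prod>i<k. sqfac (p ^ (i+1)) u / sqfac (a * p ^ (3*i+2)) u) / qpoch (p\<^sup>2) p (2*k)"

text \<open>The closed form of the telescoped partial sum in
  \<open>sum_cubic_term_telescope\<close>. It carries one more \<open>sqfac\<close> quotient than
  the summand with the same index.\<close>

definition cubic_cert :: "complex \<Rightarrow> complex \<Rightarrow> complex \<Rightarrow> nat \<Rightarrow> complex" where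
  "cubic_cert p a u n = a / p * p ^ ((n+1)*(n+2)) * qpoch a p (2*n+1)
     * (\<Prod>i<n+1. sqfac (p ^ (i+1)) u / sqfac (a * p ^ (3*i+2)) u) / qpoch (p\<^sup>2) p (2*n)"

section \<open>Finite q-Pochhammer products and a majorant series\<close>

lemma qpoch_0 [simp]: "qpoch x p 0 = 1"
  by (simp add: qpoch_def)

lemma qpoch_Suc: "qpoch x p (Suc n) = qpoch x p n * (1 - x * p ^ n)"
  by (simp add: qpoch_def)

lemma qpoch_Suc_shift: "qpoch x p (Suc n) = (1 - x) * qpoch (x * p) p n"
  by (simp add: qpoch_def prod.lessThan_Suc_shift mult.assoc del: prod.lessThan_Suc)

lemma norm_qpoch_le:
  assumes "cmod p \<le> 1"
  shows "cmod (qpoch x p n) \<le> (1 + cmod x) ^ n"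
proof -
  have "cmod (1 - x * p ^ i) \<le> 1 + cmod x" for i
  proof -
    have "cmod (x * p ^ i) \<le> cmod x * 1"
      unfolding norm_mult norm_power using assms by (intro mult_left_mono power_le_one) auto
    thus ?thesis using norm_triangle_ineq4[of 1 "x * p ^ i"] by simp
  qed
  hence "(\<Prod>i<n. cmod (1 - x * p ^ i)) \<le> (\<Prod>i<n. 1 + cmod x)"
    by (intro prod_mono) auto
  thus ?thesis by (simp add: qpoch_def prod_norm)
qed

lemma norm_qpoch_ge:
  assumes "cmod p \<le> 1" "cmod x \<le> 1"
  shows "(1 - cmod x) ^ n \<le> cmod (qpoch x p n)"
proof -
  have "1 - cmod x \<le> cmod (1 - x * p ^ i)" for i
  proof -
    have "cmod (x * p ^ i) \<le> cmod x * 1"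
      unfolding norm_mult norm_power using assms by (intro mult_left_mono power_le_one) auto
    thus ?thesis using norm_triangle_ineq2[of 1 "x * p ^ i"] by simp
  qed
  hence "(\<Prod>i<n. 1 - cmod x) \<le> (\<Prod>i<n. cmod (1 - x * p ^ i))"
    using assms by (intro prod_mono) auto
  thus ?thesis by (simp add: qpoch_def prod_norm)
qed

text \<open>The general term is the \<open>k\<close>-th power of \<open>r ^ Suc k * B\<close>, and
  this base tends to 0, so the quadratic exponent beats any geometric growth
  \<open>B ^ k\<close>.\<close>

lemma summable_power_square:
  fixes r B :: real
  assumes "0 \<le> r" "r < 1" "0 \<le> B"
  shows "summable (\<lambda>k::nat. r ^ (k\<^sup>2 + k) * B ^ k)"
proof (rule summable_comparison_test_ev)
  have "(\<lambda>k. r ^ Suc k * B) \<longlonglongrightarrow> 0"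
    using tendsto_mult_left_zero[OF LIMSEQ_Suc[OF LIMSEQ_realpow_zero[OF assms(1,2)]], of B] by simp
  hence "\<forall>\<^sub>F k in sequentially. r ^ Suc k * B < 1/2"
    by (rule order_tendstoD) auto
  thus "\<forall>\<^sub>F k in sequentially. norm (r ^ (k\<^sup>2 + k) * B ^ k) \<le> (1/2) ^ k"
  proof eventually_elim
    case (elim k)
    have "r ^ (k\<^sup>2 + k) * B ^ k = (r ^ Suc k * B) ^ k"
      by (simp add: power_mult_distrib power2_eq_square flip: power_mult power_Suc) (simp add: algebra_simps)
    also have "\<dots> \<le> (1/2) ^ k"
      using elim assms by (intro power_mono) auto
    finally show ?case using assms by simp
  qed
qed (auto intro: summable_geometric)

section \<open>Creative telescoping\<close>

text \<open>The rational function identity behind the creative telescoping, with \<open>y = p ^ k\<close>.\<close>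

lemma cubic_certificate:
  fixes a p y u :: complex
  defines "N \<equiv> sqfac (p * y) u" and "D \<equiv> sqfac (a * p\<^sup>2 * y^3) u"
    and "W \<equiv> (1 - y\<^sup>2) * (1 - p * y\<^sup>2)"
  assumes "p \<noteq> 0" "D \<noteq> 0" "W \<noteq> 0"
  shows "a / p + ((1 - a / p) * (1 - a * y^4)
           - (1 - a * y\<^sup>2 / p) * (1 - a * y\<^sup>2) * (1 - a * p * y\<^sup>2) * (1 - a * p^3 * y^4) / D) / W
         = a / p * (p\<^sup>2 * y\<^sup>2) * (N / D) * ((1 - a * y\<^sup>2 / p) * (1 - a * y\<^sup>2)) / W"
proof -
  \<comment> \<open>With \<open>a = b * p\<close> the only division by \<open>p\<close> disappears,
    so clearing \<open>D\<close> and \<open>W\<close> leaves a polynomial identity.\<close>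
  define b where "b = a / p"
  have a: "a = b * p" using assms by (simp add: b_def)
  have *: "b * W * D + (1 - b) * (1 - a * y^4) * D
           - (1 - b * y\<^sup>2) * (1 - a * y\<^sup>2) * (1 - a * p * y\<^sup>2) * (1 - a * p^3 * y^4)
         = b * (p\<^sup>2 * y\<^sup>2) * N * ((1 - b * y\<^sup>2) * (1 - a * y\<^sup>2))"
    unfolding N_def D_def W_def sqfac_def a by algebra
  have "b + ((1 - b) * (1 - a * y^4)
           - (1 - b * y\<^sup>2) * (1 - a * y\<^sup>2) * (1 - a * p * y\<^sup>2) * (1 - a * p^3 * y^4) / D) / W
        = (b * W * D + (1 - b) * (1 - a * y^4) * D
           - (1 - b * y\<^sup>2) * (1 - a * y\<^sup>2) * (1 - a * p * y\<^sup>2) * (1 - a * p^3 * y^4)) / (D * W)"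
    using assms(5,6) by (simp add: divide_simps)
  also have "\<dots> = b * (p\<^sup>2 * y\<^sup>2) * (N / D) * ((1 - b * y\<^sup>2) * (1 - a * y\<^sup>2)) / W"
    unfolding * by simp
  finally show ?thesis by (simp add: b_def)
qed

text \<open>Induction on \<open>n\<close>. In the step, the new term and both certificates share the
  factor \<open>z * A * P / B\<close>; what remains is \<open>cubic_certificate\<close> at
  \<open>y = p ^ (n+1)\<close>. The hypothesis on powers of \<open>p\<close> keeps the new
  denominator factors \<open>W\<close> nonzero.\<close>

lemma sum_cubic_term_telescope:
  assumes p: "p \<noteq> 0" and root: "\<And>n. n > 0 \<Longrightarrow> p ^ n \<noteq> 1"
    and D: "\<And>i. sqfac (a * p ^ (3*i+2)) u \<noteq> 0"
  shows "(\<Sum>k\<le>n. cubic_term p a u k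
            - (1 - a) * (1 - a * p) / sqfac (a * p\<^sup>2) u * cubic_term p (a * p^3) u k)
         = cubic_cert p a u n"
proof (induction n)
  case 0
  have D0: "sqfac (a * p\<^sup>2) u \<noteq> 0" using D[of 0] by (simp add: power2_eq_square)
  have *: "sqfac (a * p\<^sup>2) u - (1 - a * p) * (1 - a * p^3) = a * p * sqfac p u"
    unfolding sqfac_def by algebra
  have "(1 - a) - (1 - a) * (1 - a * p) / sqfac (a * p\<^sup>2) u * (1 - a * p^3)
      = (1 - a) * (sqfac (a * p\<^sup>2) u - (1 - a * p) * (1 - a * p^3)) / sqfac (a * p\<^sup>2) u"
    using D0 by (simp add: divide_simps) (simp add: algebra_simps)
  also have "\<dots> = a * p * (1 - a) * (sqfac p u / sqfac (a * p\<^sup>2) u)"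
    unfolding * by simp
  finally show ?case
    using p by (simp add: cubic_term_def cubic_cert_def qpoch_Suc power2_eq_square)
next
  case (Suc n)
  define y where "y = p ^ (n+1)"
  define z where "z = p ^ ((n+1)*(n+2))"
  define A where "A = qpoch a p (2*n+1)"
  define B where "B = qpoch (p\<^sup>2) p (2*n)"
  define P where "P = (\<Prod>i<n+1. sqfac (p ^ (i+1)) u / sqfac (a * p ^ (3*i+2)) u)"
  define Dk where "Dk = sqfac (a * p\<^sup>2 * y^3) u"
  define Nk where "Nk = sqfac (p * y) u"
  define W where "W = (1 - y\<^sup>2) * (1 - p * y\<^sup>2)"
  define D0 where "D0 = sqfac (a * p\<^sup>2) u"
  have D0: "D0 \<noteq> 0" using D[of 0] by (simp add: D0_def power2_eq_square)
  have "p ^ (3*(n+1)+2) = p\<^sup>2 * y^3"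
    unfolding y_def power_mult[symmetric] power_add[symmetric]
    by (rule arg_cong[where f="power p"]) simp
  hence Dk_eq: "sqfac (a * p ^ (3*(n+1)+2)) u = Dk"
    by (simp add: Dk_def mult.assoc)
  have Dk: "Dk \<noteq> 0" using D[of "n+1"] unfolding Dk_eq .
  have y2: "y\<^sup>2 = p ^ (2*n+2)"
    unfolding y_def power_mult[symmetric] by (rule arg_cong[where f="power p"]) simp
  have y4: "y^4 = p ^ (4*(n+1))"
    unfolding y_def power_mult[symmetric] by (rule arg_cong[where f="power p"]) simp
  have y2p: "a * y\<^sup>2 / p = a * p ^ (2*n+1)" unfolding y2 using p by (simp add: power2_eq_square)
  have py2: "p * y\<^sup>2 = p ^ (2*n+3)"
    unfolding y2 power_Suc[symmetric] by (rule arg_cong[where f="power p"]) simp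
  have r: "1 - p ^ m \<noteq> 0" if "m > 0" for m using root[OF that] by (metis right_minus_eq)
  have W: "W \<noteq> 0" unfolding W_def py2 unfolding y2 by (intro no_zero_divisors r) simp_all
  have e: "p\<^sup>2 * p ^ (2*n) = p ^ (2*n+2)" "p\<^sup>2 * p ^ Suc (2*n) = p ^ (2*n+3)"
    unfolding power_add[symmetric] by (rule arg_cong[where f="power p"], simp)+
  have "qpoch (p\<^sup>2) p (Suc (Suc (2*n))) = B * W"
    unfolding qpoch_Suc e B_def W_def py2 unfolding y2 by simp
  hence B2: "qpoch (p\<^sup>2) p (2*(n+1)) = B * W" by simp
  have z2: "p ^ ((n+1)\<^sup>2 + (n+1)) = z"
    unfolding z_def by (rule arg_cong[where f="power p"]) (simp add: power2_eq_square)
  have z3: "p ^ ((n+2)*(n+3)) = z * (p\<^sup>2 * y\<^sup>2)"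
    unfolding y2 z_def power_add[symmetric] by (rule arg_cong[where f="power p"]) (simp add: algebra_simps)
  have A1: "qpoch (a / p) p (2*(n+1)) = (1 - a / p) * A"
    using p by (simp add: A_def qpoch_Suc_shift[of "a/p"])
  have A3: "qpoch a p (2*n+3) = A * ((1 - a * y\<^sup>2 / p) * (1 - a * y\<^sup>2))"
    unfolding y2p unfolding y2 A_def by (simp add: eval_nat_numeral qpoch_Suc)
  have A4: "qpoch a p (2*n+4) = A * ((1 - a * y\<^sup>2 / p) * (1 - a * y\<^sup>2) * (1 - a * p * y\<^sup>2))"
  proof -
    have "2*n+4 = Suc (2*n+3)" by simp
    thus ?thesis by (simp only: qpoch_Suc A3 py2[symmetric] mult.assoc)
  qed
  \<comment> \<open>Since \<open>a * p^3 / p = a * p * p\<close>, the prefactor supplies exactly the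
    two missing initial factors of a product starting at \<open>a\<close>.\<close>
  have A2: "(1 - a) * (1 - a * p) * qpoch (a * p^3 / p) p (2*(n+1))
          = A * ((1 - a * y\<^sup>2 / p) * (1 - a * y\<^sup>2) * (1 - a * p * y\<^sup>2))"
  proof -
    have "a * p^3 / p = a * p * p" using p by (simp add: power3_eq_cube)
    hence "(1 - a) * (1 - a * p) * qpoch (a * p^3 / p) p (2*(n+1)) = qpoch a p (Suc (Suc (2*(n+1))))"
      by (simp only: qpoch_Suc_shift) (simp add: mult.assoc)
    also have "Suc (Suc (2*(n+1))) = 2*n+4" by simp
    finally show ?thesis unfolding A4 .
  qed
  \<comment> \<open>Replacing \<open>a\<close> by \<open>a * p^3\<close> shifts the index of the
    denominators by one: the product gains the last factor \<open>Dk\<close> and loses the first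
    factor \<open>D0\<close>. The lost \<open>D0\<close> later cancels against the coefficient of
    the shifted series.\<close>
  have P3: "(\<Prod>i<n+1. sqfac (p ^ (i+1)) u / sqfac (a * p^3 * p ^ (3*i+2)) u) = P * D0 / Dk"
  proof -
    have e: "a * p^3 * p ^ (3*i+2) = a * p ^ (3 * Suc i + 2)" for i
      by (simp add: power_add eval_nat_numeral)
    have "(\<Prod>i<n+1. sqfac (a * p ^ (3*i+2)) u) * Dk = (\<Prod>i<Suc (n+1). sqfac (a * p ^ (3*i+2)) u)"
      using Dk_eq by (simp only: prod.lessThan_Suc)
    also have "\<dots> = D0 * (\<Prod>i<n+1. sqfac (a * p^3 * p ^ (3*i+2)) u)"
      unfolding e by (subst prod.lessThan_Suc_shift) (simp add: D0_def power2_eq_square)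
    finally have "(\<Prod>i<n+1. sqfac (a * p^3 * p ^ (3*i+2)) u)
                 = (\<Prod>i<n+1. sqfac (a * p ^ (3*i+2)) u) * Dk / D0"
      using D0 by (simp add: field_simps)
    thus ?thesis unfolding P_def prod_dividef by simp
  qed
  have T1: "cubic_term p a u (n+1) = z * A * P / B * ((1 - a / p) * (1 - a * y^4) / W)"
    unfolding cubic_term_def A1 B2 z2 P_def[symmetric] y4 by simp
  have "(1 - a) * (1 - a * p) / D0 * cubic_term p (a * p^3) u (n+1)
      = ((1 - a) * (1 - a * p) * qpoch (a * p^3 / p) p (2*(n+1))) / D0 * z * (1 - a * p^3 * y^4)
          * (P * D0 / Dk) / (B * W)"
    unfolding cubic_term_def B2 z2 P3 y4 by simp
  also have "\<dots> = z * A * P / B *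
      ((1 - a * y\<^sup>2 / p) * (1 - a * y\<^sup>2) * (1 - a * p * y\<^sup>2) * (1 - a * p^3 * y^4) / Dk / W)"
    unfolding A2 using D0 by simp (simp add: mult_ac)
  finally have T2: "(1 - a) * (1 - a * p) / D0 * cubic_term p (a * p^3) u (n+1) = \<dots>" .
  have N_eq: "sqfac (p ^ (n+1+1)) u = Nk" by (simp add: Nk_def y_def)
  have C1: "cubic_cert p a u n = z * A * P / B * (a / p)"
    unfolding cubic_cert_def A_def[symmetric] B_def[symmetric] P_def[symmetric] z_def[symmetric]
    by (simp add: mult_ac)
  have i: "n+1+2 = n+3" "n+1+1 = n+2" "2*(n+1)+1 = 2*n+3" by auto
  have P2: "(\<Prod>i<n+2. sqfac (p ^ (i+1)) u / sqfac (a * p ^ (3*i+2)) u) = P * (Nk / Dk)"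
  proof -
    have "n+2 = Suc (n+1)" by simp
    thus ?thesis unfolding P_def using N_eq Dk_eq by (simp only: prod.lessThan_Suc)
  qed
  have C2: "cubic_cert p a u (n+1) = z * A * P / B *
      (a / p * (p\<^sup>2 * y\<^sup>2) * (Nk / Dk) * ((1 - a * y\<^sup>2 / p) * (1 - a * y\<^sup>2)) / W)"
    unfolding cubic_cert_def i A3 B2 z3 P2 by (simp add: mult_ac)
  have "cubic_cert p a u n + (cubic_term p a u (n+1)
          - (1 - a) * (1 - a * p) / D0 * cubic_term p (a * p^3) u (n+1)) = cubic_cert p a u (n+1)"
    unfolding T1 T2 C1 C2
    unfolding cubic_certificate[of p a y u, folded Nk_def Dk_def W_def, OF p Dk W, symmetric]
    by (simp add: ring_distribs diff_divide_distrib add_divide_distrib)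
  thus ?case using Suc.IH by (simp add: D0_def)
qed


section \<open>Analytic properties of the factors and infinite products\<close>

lemma sqfac_0 [simp]: "sqfac y 0 = (1 - y)\<^sup>2"
  by (simp add: sqfac_def)

lemma norm_sqfac_le:
  assumes "cmod y \<le> 1" "cmod u \<le> 1"
  shows "cmod (sqfac y u) \<le> 5"
proof -
  have 1: "cmod (1 - y) \<le> 2" using norm_triangle_ineq4[of 1 y] assms by simp
  have "cmod (y * u) \<le> 1" using assms by (simp add: norm_mult mult_le_one)
  moreover have "cmod ((1 - y)\<^sup>2) \<le> 2\<^sup>2"
    unfolding norm_power using 1 by (intro power_mono) auto
  ultimately show ?thesis
    unfolding sqfac_def using norm_triangle_ineq4[of "(1-y)\<^sup>2" "y*u"] by simp
qed

lemma has_field_derivative_sqfac [derivative_intros]: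
  "((\<lambda>u. sqfac y u) has_field_derivative - y) (at u within A)"
  unfolding sqfac_def by (auto intro!: derivative_eq_intros)

lemma continuous_on_sqfac [continuous_intros]:
  "continuous_on A f \<Longrightarrow> continuous_on A g \<Longrightarrow> continuous_on A (\<lambda>x. sqfac (f x) (g x))"
  unfolding sqfac_def by (intro continuous_intros)

lemma holomorphic_on_sqfac [holomorphic_intros]:
  "(\<lambda>u. sqfac y u) holomorphic_on A"
  unfolding sqfac_def by (intro holomorphic_intros)

lemma continuous_on_qpoch [continuous_intros]:
  "continuous_on A f \<Longrightarrow> continuous_on A (\<lambda>x. qpoch (f x) p n)"
  unfolding qpoch_def by (intro continuous_intros)

lemma convergent_prod_qpoch:
  assumes "cmod p < 1"
  shows "convergent_prod (\<lambda>i. 1 - x * p ^ i)"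
proof -
  have "summable (\<lambda>i. norm (1 - x * p ^ i - 1))"
    using assms by (simp add: norm_mult norm_power summable_mult summable_geometric)
  thus ?thesis
    using abs_convergent_prod_conv_summable abs_convergent_prod_imp_convergent_prod by blast
qed

lemma qpoch_LIMSEQ:
  assumes "cmod p < 1"
  shows "(\<lambda>n. qpoch x p n) \<longlonglongrightarrow> qpochinf x p"
  unfolding qpoch_def qpochinf_def
  using has_prod_imp_tendsto'[OF convergent_prod_has_prod[OF convergent_prod_qpoch[OF assms]]] .

lemma qpochinf_nonzero:
  assumes "cmod p < 1" "cmod x < 1"
  shows "qpochinf x p \<noteq> 0"
proof -
  have "1 - x * p ^ i \<noteq> 0" for i
  proof -
    have "cmod (x * p ^ i) \<le> cmod x * 1"
      unfolding norm_mult norm_power using assms by (intro mult_left_mono power_le_one) auto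
    also have "\<dots> < cmod 1" using assms by simp
    finally show ?thesis by auto
  qed
  thus ?thesis unfolding qpochinf_def
    using prodinf_nonzero[OF convergent_prod_qpoch[OF assms(1)]] by blast
qed

lemma qpochinf_shift:
  assumes "cmod p < 1"
  shows "qpochinf x p = (1 - x) * qpochinf (x * p) p"
proof (rule LIMSEQ_unique)
  show "(\<lambda>n. qpoch x p (Suc n)) \<longlonglongrightarrow> qpochinf x p"
    using qpoch_LIMSEQ[OF assms] by (rule LIMSEQ_Suc)
  show "(\<lambda>n. qpoch x p (Suc n)) \<longlonglongrightarrow> (1 - x) * qpochinf (x * p) p"
    unfolding qpoch_Suc_shift by (intro tendsto_intros qpoch_LIMSEQ assms)
qed

text \<open>The exponents are sorted by their residue modulo 3. This links products to base
  \<open>p\<close>, as in the theorem, with those to base \<open>p^3\<close> produced by the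
  iteration.\<close>

lemma qpoch_trisect:
  "qpoch x p (3*n) = qpoch x (p^3) n * qpoch (x * p) (p^3) n * qpoch (x * p\<^sup>2) (p^3) n"
proof (induction n)
  case (Suc n)
  have "3 * Suc n = Suc (Suc (Suc (3*n)))" by simp
  thus ?case
    by (simp only: qpoch_Suc Suc.IH) (simp add: power_mult[symmetric] power2_eq_square ac_simps)
qed simp

lemma qpochinf_trisect:
  assumes "cmod p < 1"
  shows "qpochinf x p = qpochinf x (p^3) * qpochinf (x * p) (p^3) * qpochinf (x * p\<^sup>2) (p^3)"
proof (rule LIMSEQ_unique)
  have "strict_mono (\<lambda>n::nat. 3*n)" by (simp add: strict_mono_def)
  from LIMSEQ_subseq_LIMSEQ[OF qpoch_LIMSEQ[OF assms] this]
  show "(\<lambda>n. qpoch x p (3*n)) \<longlonglongrightarrow> qpochinf x p" by (simp add: o_def)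
  have "cmod (p^3) < 1" using assms by (simp add: norm_power power_less_one_iff)
  thus "(\<lambda>n. qpoch x p (3*n)) \<longlonglongrightarrow>
          qpochinf x (p^3) * qpochinf (x * p) (p^3) * qpochinf (x * p\<^sup>2) (p^3)"
    unfolding qpoch_trisect by (intro tendsto_intros qpoch_LIMSEQ)
qed

section \<open>Bounds uniform in the parameter and in the deformation\<close>

locale cubic_base =
  fixes p :: complex
  assumes p_nonzero: "p \<noteq> 0" and norm_p: "cmod p < 1"
begin

text \<open>Half of the lower bound for \<open>|1 - y|^2\<close> when \<open>|y| \<le> |p|\<close>:
  the perturbation \<open>y * u\<close> then leaves the other half, so \<open>sqfac y u\<close>
  stays away from 0.\<close>

definition rad :: real where "rad = (1 - cmod p)\<^sup>2 / 2"

text \<open>This disc contains \<open>1/q\<close> when \<open>p = q^2\<close>, as well as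
  \<open>p\<close> and 0, and it is stable under multiplication by \<open>p\<close>. On it all
  arguments \<open>a * p ^ (3*i+2)\<close> have modulus at most \<open>|p|\<close>.\<close>

definition dom :: "complex set" where "dom = cball 0 (1 / cmod p)"

lemma rad_pos: "rad > 0" and rad_le_1: "rad \<le> 1"
  using norm_p by (auto simp: rad_def power_le_one intro: order.trans[OF power_le_one[of "1 - cmod p" 2]])

lemma norm_p3: "cmod (p^3) < 1"
  using norm_p by (simp add: norm_power power_less_one_iff)

lemma power_p_neq_1: "n > 0 \<Longrightarrow> p ^ n \<noteq> 1"
  using norm_p by (metis less_numeral_extra(4) norm_one norm_power norm_ge_zero power_less_one_iff)

text \<open>One factor \<open>p\<close> compensates \<open>|a| \<le> 1 / |p|\<close>, and
  \<open>3*i+1 \<ge> i+1\<close> factors remain. This geometric decay makes the infinite products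
  converge.\<close>

lemma dom_bound:
  assumes "a \<in> dom"
  shows "cmod (a * p ^ (3*i+2)) \<le> cmod p ^ Suc i"
proof -
  have "cmod a * cmod p \<le> 1" using assms p_nonzero by (simp add: dom_def field_simps)
  hence "cmod a * cmod p * cmod p ^ (3*i+1) \<le> 1 * cmod p ^ (3*i+1)"
    by (intro mult_right_mono) auto
  also have "\<dots> \<le> cmod p ^ Suc i"
    using norm_p by (simp only: mult_1) (intro power_decreasing, auto)
  finally show ?thesis by (simp add: norm_mult norm_power mult.assoc)
qed

lemma dom_bound':
  assumes "a \<in> dom"
  shows "cmod (a * p ^ (3*i+2)) \<le> cmod p"
  using dom_bound[OF assms, of i] power_decreasing[of 1 "Suc i" "cmod p"] norm_p
  by (simp del: power_Suc)

lemma dom_mult: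
  assumes "a \<in> dom" shows "a * p ^ n \<in> dom"
proof -
  have "cmod a * cmod p ^ n \<le> cmod a * 1"
    using norm_p by (intro mult_left_mono power_le_one) auto
  thus ?thesis using assms by (simp add: dom_def norm_mult norm_power)
qed

lemma p_in_dom: "p \<in> dom"
proof -
  have "cmod p * cmod p \<le> 1" using norm_p by (intro mult_le_one) auto
  thus ?thesis using p_nonzero by (simp add: dom_def field_simps)
qed

lemma zero_in_dom: "0 \<in> dom"
  by (simp add: dom_def)

lemma norm_sqfac_ge:
  assumes "cmod y \<le> cmod p" "cmod u \<le> rad"
  shows "rad \<le> cmod (sqfac y u)"
proof -
  have "1 - cmod p \<le> cmod (1 - y)" using norm_triangle_ineq2[of 1 y] assms by simp
  hence "(1 - cmod p)\<^sup>2 \<le> cmod ((1 - y)\<^sup>2)"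
    unfolding norm_power using norm_p by (intro power_mono) auto
  moreover have "cmod (y * u) \<le> 1 * rad"
    unfolding norm_mult using assms norm_p rad_pos by (intro mult_mono) auto
  ultimately show ?thesis
    unfolding sqfac_def using norm_triangle_ineq2[of "(1-y)\<^sup>2" "y*u"] by (simp add: rad_def)
qed

lemma sqfac_dom_nonzero:
  assumes "a \<in> dom" "cmod u \<le> rad"
  shows "sqfac (a * p ^ (3*i+2)) u \<noteq> 0"
  using norm_sqfac_ge[OF dom_bound'[OF assms(1), of i] assms(2)] rad_pos by (metis norm_zero not_le)

lemma norm_prod_sqfac_le:
  assumes "a \<in> dom" "cmod u \<le> rad"
  shows "cmod (\<Prod>i<k. sqfac (p ^ (i+1)) u / sqfac (a * p ^ (3*i+2)) u) \<le> (5 / rad) ^ k"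
proof -
  have "cmod (sqfac (p ^ (i+1)) u / sqfac (a * p ^ (3*i+2)) u) \<le> 5 / rad" for i
  proof -
    have "cmod (p ^ (i+1)) \<le> 1"
      unfolding norm_power using norm_p by (intro power_le_one) auto
    thus ?thesis unfolding norm_divide
      using assms rad_pos rad_le_1
      by (intro frac_le norm_sqfac_le norm_sqfac_ge dom_bound') auto
  qed
  hence "(\<Prod>i<k. cmod (sqfac (p ^ (i+1)) u / sqfac (a * p ^ (3*i+2)) u)) \<le> (\<Prod>i<k. 5 / rad)"
    by (intro prod_mono) auto
  thus ?thesis by (simp add: prod_norm)
qed

definition qbound :: real where "qbound = 1 + 1 / (cmod p)\<^sup>2"

text \<open>Growth of the summand per index, apart from the power of \<open>p\<close>: two
  Pochhammer factors above, one \<open>sqfac\<close> quotient, two Pochhammer factors below.\<close>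

definition ratio_bound :: real where
  "ratio_bound = qbound\<^sup>2 * (5 / rad) / (1 - cmod (p\<^sup>2))\<^sup>2"

lemma norm_p2: "cmod (p\<^sup>2) < 1"
  using norm_p by (simp add: norm_power power_less_one_iff)

lemma ratio_bound_nonneg: "ratio_bound \<ge> 0"
  using rad_pos by (simp add: ratio_bound_def)

lemma norm_qpoch_p2_ge: "(1 - cmod (p\<^sup>2)) ^ n \<le> cmod (qpoch (p\<^sup>2) p n)"
  using norm_p norm_p2 by (intro norm_qpoch_ge) auto

text \<open>The bound depends on neither \<open>a\<close> nor \<open>u\<close>, so one majorant
  gives convergence, continuity in \<open>a\<close> and termwise differentiation in
  \<open>u\<close>.\<close>

lemma norm_cubic_term_le:
  assumes "a \<in> dom" "cmod u \<le> rad"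
  shows "cmod (cubic_term p a u k) \<le> (cmod p ^ (k\<^sup>2 + k) * ratio_bound ^ k) * (1 + 1 / cmod p)"
proof -
  have a: "cmod a \<le> 1 / cmod p" using assms by (simp add: dom_def)
  have 1: "cmod (1 - a * p ^ (4*k)) \<le> 1 + 1 / cmod p"
    using norm_triangle_ineq4[of 1 "a * p ^ (4*k)"] dom_mult[OF assms(1), of "4*k"]
    by (simp add: dom_def)
  have "cmod (a / p) \<le> 1 / (cmod p)\<^sup>2"
    using divide_right_mono[OF a, of "cmod p"] by (simp add: norm_divide power2_eq_square)
  hence "(1 + cmod (a/p)) ^ (2*k) \<le> qbound ^ (2*k)"
    unfolding qbound_def by (intro power_mono) auto
  hence 2: "cmod (qpoch (a / p) p (2*k)) \<le> qbound ^ (2*k)"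
    using norm_qpoch_le[of p "a/p" "2*k"] norm_p by simp
  have q0: "qbound \<ge> 0" by (simp add: qbound_def)
  have "cmod (cubic_term p a u k) \<le>
     cmod p ^ (k\<^sup>2 + k) * (1 + 1 / cmod p) * qbound ^ (2*k) * (5 / rad) ^ k / (1 - cmod (p\<^sup>2)) ^ (2*k)"
    unfolding cubic_term_def norm_mult norm_divide norm_power[of p "k\<^sup>2 + k"]
    using norm_p2 rad_pos q0
    by (intro frac_le mult_mono 1 2 norm_prod_sqfac_le assms norm_qpoch_p2_ge mult_nonneg_nonneg) auto
  also have "\<dots> = (cmod p ^ (k\<^sup>2 + k) * ratio_bound ^ k) * (1 + 1 / cmod p)"
    by (simp add: ratio_bound_def power_mult power_mult_distrib power_divide)
  finally show ?thesis .
qed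

lemma summable_majorant: "summable (\<lambda>k. (cmod p ^ (k\<^sup>2 + k) * ratio_bound ^ k) * C)"
  using norm_p ratio_bound_nonneg by (intro summable_mult2 summable_power_square) auto

text \<open>The boundary term of the telescoping vanishes in the limit, because the majorant of the
  summand also dominates the certificate up to a constant.\<close>

lemma cubic_cert_LIMSEQ:
  assumes "a \<in> dom" "cmod u \<le> rad"
  shows "(\<lambda>n. cubic_cert p a u n) \<longlonglongrightarrow> 0"
proof (rule Lim_null_comparison)
  \<comment> \<open>The constant collects the bound for \<open>a / p\<close>, the one surplus
    Pochhammer factor and the one surplus \<open>sqfac\<close> quotient.\<close>
  let ?C = "1 / (cmod p)\<^sup>2 * qbound * (5 / rad)"
  show "(\<lambda>k. (cmod p ^ (k\<^sup>2 + k) * ratio_bound ^ k) * ?C) \<longlonglongrightarrow> 0"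
    by (rule summable_LIMSEQ_zero[OF summable_majorant])
  have a: "cmod a \<le> 1 / cmod p" using assms by (simp add: dom_def)
  have ap: "cmod (a / p) \<le> 1 / (cmod p)\<^sup>2"
    using divide_right_mono[OF a, of "cmod p"] by (simp add: norm_divide power2_eq_square)
  have "1 / cmod p \<le> 1 / (cmod p)\<^sup>2"
    using p_nonzero norm_p by (simp add: field_simps power2_eq_square)
  hence a2: "1 + cmod a \<le> qbound" using a by (simp add: qbound_def)
  have q0: "qbound \<ge> 0" by (simp add: qbound_def)
  have "cmod (cubic_cert p a u n) \<le> (cmod p ^ (n\<^sup>2 + n) * ratio_bound ^ n) * ?C" for n
  proof -
    have 1: "cmod p ^ ((n+1)*(n+2)) \<le> cmod p ^ (n\<^sup>2 + n)"
      using norm_p by (intro power_decreasing) (auto simp: power2_eq_square)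
    have "(1 + cmod a) ^ (2*n+1) \<le> qbound ^ (2*n+1)"
      using a2 by (intro power_mono) auto
    hence 2: "cmod (qpoch a p (2*n+1)) \<le> qbound ^ (2*n+1)"
      using norm_qpoch_le[of p a "2*n+1"] norm_p by simp
    have "cmod (cubic_cert p a u n) \<le>
      1 / (cmod p)\<^sup>2 * cmod p ^ (n\<^sup>2 + n) * qbound ^ (2*n+1) * (5 / rad) ^ (n+1) / (1 - cmod (p\<^sup>2)) ^ (2*n)"
      unfolding cubic_cert_def norm_mult norm_divide[of _ "qpoch _ _ _"] norm_power[of p "(n+1)*(n+2)"]
      using norm_p2 rad_pos q0
      by (intro frac_le mult_mono ap 1 2 norm_prod_sqfac_le assms norm_qpoch_p2_ge mult_nonneg_nonneg) auto
    also have "\<dots> = (cmod p ^ (n\<^sup>2 + n) * ratio_bound ^ n) * ?C"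
      by (simp add: ratio_bound_def power_mult power_mult_distrib power_divide) (simp add: mult_ac)
    finally show ?thesis .
  qed
  thus "\<forall>\<^sub>F n in sequentially. norm (cubic_cert p a u n)
          \<le> (cmod p ^ (n\<^sup>2 + n) * ratio_bound ^ n) * ?C" by simp
qed

section \<open>The functional equation and its iteration\<close>

definition cubic_sum :: "complex \<Rightarrow> complex \<Rightarrow> complex" where
  "cubic_sum a u = (\<Sum>k. cubic_term p a u k)"

lemma cubic_term_sums:
  assumes "a \<in> dom" "cmod u \<le> rad"
  shows "cubic_term p a u sums cubic_sum a u"
  unfolding cubic_sum_def
  using norm_cubic_term_le[OF assms]
  by (intro summable_sums summable_comparison_test[OF _ summable_majorant]) blast

text \<open>The partial sums of the difference of the two series equal \<open>cubic_cert\<close>,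
  which tends to 0.\<close>

lemma cubic_sum_step:
  assumes "a \<in> dom" "cmod u \<le> rad"
  shows "sqfac (a * p\<^sup>2) u * cubic_sum a u = (1 - a) * (1 - a * p) * cubic_sum (a * p^3) u"
proof -
  define c where "c = (1 - a) * (1 - a * p) / sqfac (a * p\<^sup>2) u"
  have D0: "sqfac (a * p\<^sup>2) u \<noteq> 0"
    using sqfac_dom_nonzero[OF assms, of 0] by (simp add: numeral_2_eq_2)
  have "(\<lambda>k. cubic_term p a u k - c * cubic_term p (a * p^3) u k)
          sums (cubic_sum a u - c * cubic_sum (a * p^3) u)"
    by (intro sums_diff sums_mult cubic_term_sums assms dom_mult)
  hence "(\<lambda>n. \<Sum>k\<le>n. cubic_term p a u k - c * cubic_term p (a * p^3) u k)
          \<longlonglongrightarrow> cubic_sum a u - c * cubic_sum (a * p^3) u"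
    by (simp add: sums_def_le)
  also have "(\<lambda>n. \<Sum>k\<le>n. cubic_term p a u k - c * cubic_term p (a * p^3) u k) = cubic_cert p a u"
    unfolding c_def
    using sum_cubic_term_telescope[OF p_nonzero power_p_neq_1 sqfac_dom_nonzero[OF assms]] by blast
  finally have "cubic_sum a u - c * cubic_sum (a * p^3) u = 0"
    using cubic_cert_LIMSEQ[OF assms] LIMSEQ_unique by blast
  thus ?thesis using D0 by (simp add: c_def field_simps)
qed

lemma cubic_sum_iterate:
  assumes "a \<in> dom" "cmod u \<le> rad"
  shows "(\<Prod>m<n. sqfac (a * p ^ (3*m+2)) u) * cubic_sum a u
         = qpoch a (p^3) n * qpoch (a * p) (p^3) n * cubic_sum (a * p ^ (3*n)) u"
proof (induction n)
  case (Suc n)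
  let ?b = "a * p ^ (3*n)"
  have b: "?b * p\<^sup>2 = a * p ^ (3*n+2)" "?b * p^3 = a * p ^ (3 * Suc n)"
    by (simp_all add: power_add[symmetric] mult.assoc del: power_Suc) (simp add: add.commute)
  have "(\<Prod>m<Suc n. sqfac (a * p ^ (3*m+2)) u) * cubic_sum a u
      = sqfac (a * p ^ (3*n+2)) u * ((\<Prod>m<n. sqfac (a * p ^ (3*m+2)) u) * cubic_sum a u)"
    by simp
  also have "\<dots> = qpoch a (p^3) n * qpoch (a * p) (p^3) n * (sqfac (a * p ^ (3*n+2)) u * cubic_sum ?b u)"
    unfolding Suc.IH by simp
  also have "sqfac (a * p ^ (3*n+2)) u * cubic_sum ?b u
      = (1 - ?b) * (1 - ?b * p) * cubic_sum (a * p ^ (3 * Suc n)) u"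
    using cubic_sum_step[OF dom_mult[OF assms(1), of "3*n"] assms(2)] unfolding b .
  finally show ?case by (simp add: qpoch_Suc power_mult[symmetric] ac_simps)
qed simp

text \<open>A uniform limit of continuous partial sums. Continuity matters at 0, where the arguments
  \<open>a * p ^ (3*n)\<close> of the iteration accumulate.\<close>

lemma continuous_on_cubic_sum:
  assumes "cmod u \<le> rad"
  shows "continuous_on dom (\<lambda>a. cubic_sum a u)"
proof (rule uniform_limit_theorem)
  show "uniform_limit dom (\<lambda>n a. \<Sum>k<n. cubic_term p a u k) (\<lambda>a. cubic_sum a u) sequentially"
    unfolding cubic_sum_def
    by (rule Weierstrass_m_test[OF norm_cubic_term_le[OF _ assms] summable_majorant])
  have qp: "qpoch (p\<^sup>2) p n \<noteq> 0" for n
    using norm_qpoch_p2_ge[of n] norm_p2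
    by (metis diff_gt_0_iff_gt norm_zero not_le zero_less_power)
  have "continuous_on dom (\<lambda>a. cubic_term p a u k)" for k
    unfolding cubic_term_def
    by (intro continuous_intros ballI qp sqfac_dom_nonzero[OF _ assms] p_nonzero)
  thus "\<forall>\<^sub>F n in sequentially. continuous_on dom (\<lambda>a. \<Sum>k<n. cubic_term p a u k)"
    by (intro always_eventually allI continuous_on_sum)
qed simp

lemma cubic_sum_LIMSEQ:
  assumes "a \<in> dom" "cmod u \<le> rad"
  shows "(\<lambda>n. cubic_sum (a * p ^ (3*n)) u) \<longlonglongrightarrow> cubic_sum 0 u"
proof (rule continuous_on_tendsto_compose[OF continuous_on_cubic_sum[OF assms(2)]])
  have "(\<lambda>n. a * (p^3) ^ n) \<longlonglongrightarrow> a * 0"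
    by (intro tendsto_intros LIMSEQ_power_zero norm_p3)
  thus "(\<lambda>n. a * p ^ (3*n)) \<longlonglongrightarrow> 0" by (simp add: power_mult)
qed (use zero_in_dom dom_mult[OF assms(1)] in auto)

text \<open>For \<open>k > 0\<close> the factor \<open>qpoch (p / p) p (2*k)\<close> starts with
  \<open>1 - 1\<close>. Only the term \<open>k = 0\<close> survives, and it is free of
  \<open>u\<close>.\<close>

lemma cubic_sum_p: "cubic_sum p u = 1 - p"
proof -
  have "cubic_term p p u k = 0" if "k \<notin> {0}" for k
  proof -
    have "2 * k = Suc (2*k - 1)" using that by simp
    hence "qpoch 1 p (2*k) = 0" by (metis diff_self mult_zero_left qpoch_Suc_shift)
    thus ?thesis using p_nonzero by (simp add: cubic_term_def)
  qed
  hence "cubic_sum p u = (\<Sum>k\<in>{0}. cubic_term p p u k)"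
    unfolding cubic_sum_def by (intro suminf_finite) auto
  thus ?thesis by (simp add: cubic_term_def)
qed

section \<open>The deformed infinite product and the closed form\<close>

text \<open>A deformation of the square of \<open>qpochinf (a * p^2) (p^3)\<close>, which is its
  value at \<open>u = 0\<close>. The pointwise \<open>lim\<close> is the form in which uniform
  convergence delivers its limit function.\<close>

definition sqprod :: "complex \<Rightarrow> complex \<Rightarrow> complex" where
  "sqprod a u = lim (\<lambda>n. \<Prod>m<n. sqfac (a * p ^ (3*m+2)) u)"

text \<open>With \<open>y = a * p ^ (3*m+2)\<close> a factor differs from 1 by
  \<open>y * (y - u - 2)\<close>. The second factor has modulus at most 4 and \<open>y\<close>
  decays geometrically, so the M-test applies.\<close>

lemma sqprod_uniform_limit:
  assumes "a \<in> dom"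
  shows "uniform_limit (cball 0 rad) (\<lambda>n u. \<Prod>m<n. sqfac (a * p ^ (3*m+2)) u) (sqprod a) sequentially"
proof -
  have bd: "norm (norm (sqfac (a * p ^ (3*m+2)) u - 1)) \<le> 4 * cmod p ^ Suc m" if "u \<in> cball 0 rad" for m u
  proof -
    let ?y = "a * p ^ (3*m+2)"
    have "sqfac ?y u - 1 = ?y * (?y - u - 2)" unfolding sqfac_def by algebra
    moreover have "cmod (?y - u - 2) \<le> 4"
    proof -
      have "cmod (?y - u - 2) \<le> cmod ?y + cmod u + cmod 2"
        by (meson norm_triangle_ineq4 norm_triangle_le_diff order.trans add_right_mono)
      also have "\<dots> \<le> 1 + 1 + 2"
        using dom_bound'[OF assms, of m] norm_p that rad_le_1 by (intro add_mono) auto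
      finally show ?thesis by simp
    qed
    ultimately have "cmod (sqfac ?y u - 1) \<le> cmod p ^ Suc m * 4"
      unfolding norm_mult[of "?y"] using dom_bound[OF assms, of m] by (auto intro!: mult_mono simp: norm_mult)
    thus ?thesis by simp
  qed
  have "summable (\<lambda>m. 4 * cmod p ^ Suc m)"
    using norm_p by (intro summable_mult) (simp add: summable_mult summable_geometric)
  hence "uniformly_convergent_on (cball 0 rad) (\<lambda>N u. \<Sum>m<N. norm (sqfac (a * p ^ (3*m+2)) u - 1))"
    by (intro Weierstrass_m_test'[OF bd])
  hence "uniformly_convergent_on (cball 0 rad) (\<lambda>n u. \<Prod>m<n. sqfac (a * p ^ (3*m+2)) u)"
    by (intro uniformly_convergent_on_prod' continuous_intros) auto
  thus ?thesis unfolding sqprod_def uniformly_convergent_uniform_limit_iff .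
qed

lemma sqprod_LIMSEQ:
  assumes "a \<in> dom" "cmod u \<le> rad"
  shows "(\<lambda>n. \<Prod>m<n. sqfac (a * p ^ (3*m+2)) u) \<longlonglongrightarrow> sqprod a u"
  using tendsto_uniform_limitI[OF sqprod_uniform_limit[OF assms(1)], of u] assms(2) by simp

lemma sqprod_0:
  assumes "a \<in> dom"
  shows "sqprod a 0 = (qpochinf (a * p\<^sup>2) (p^3))\<^sup>2"
proof (rule LIMSEQ_unique)
  show "(\<lambda>n. \<Prod>m<n. sqfac (a * p ^ (3*m+2)) 0) \<longlonglongrightarrow> sqprod a 0"
    using rad_pos by (intro sqprod_LIMSEQ assms) auto
  have "(\<Prod>m<n. sqfac (a * p ^ (3*m+2)) 0) = (qpoch (a * p\<^sup>2) (p^3) n)\<^sup>2" for n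
  proof -
    have "a * p ^ (3*m+2) = a * p\<^sup>2 * (p^3) ^ m" for m
      unfolding power_add power_mult by (simp only: mult_ac)
    thus ?thesis by (simp only: qpoch_def prod_power_distrib sqfac_0)
  qed
  thus "(\<lambda>n. \<Prod>m<n. sqfac (a * p ^ (3*m+2)) 0) \<longlonglongrightarrow> (qpochinf (a * p\<^sup>2) (p^3))\<^sup>2"
    by (simp only:) (intro tendsto_intros qpoch_LIMSEQ norm_p3)
qed

lemma norm_dom_p2: "a \<in> dom \<Longrightarrow> cmod (a * p\<^sup>2) < 1"
  using dom_bound'[of a 0] norm_p by (simp add: numeral_2_eq_2)

lemma qpochinf_dom_nonzero: "a \<in> dom \<Longrightarrow> qpochinf (a * p\<^sup>2) (p^3) \<noteq> 0"
  by (intro qpochinf_nonzero norm_p3 norm_dom_p2)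

lemma cubic_sum_sqprod:
  assumes "a \<in> dom" "cmod u \<le> rad"
  shows "sqprod a u * cubic_sum a u = qpochinf a (p^3) * qpochinf (a * p) (p^3) * cubic_sum 0 u"
proof (rule LIMSEQ_unique)
  show "(\<lambda>n. (\<Prod>m<n. sqfac (a * p ^ (3*m+2)) u) * cubic_sum a u) \<longlonglongrightarrow> sqprod a u * cubic_sum a u"
    by (intro tendsto_intros sqprod_LIMSEQ assms)
  show "(\<lambda>n. (\<Prod>m<n. sqfac (a * p ^ (3*m+2)) u) * cubic_sum a u) \<longlonglongrightarrow>
          qpochinf a (p^3) * qpochinf (a * p) (p^3) * cubic_sum 0 u"
    unfolding cubic_sum_iterate[OF assms]
    by (intro tendsto_intros qpoch_LIMSEQ norm_p3 cubic_sum_LIMSEQ assms)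
qed

text \<open>The part of the closed form that is independent of \<open>u\<close>; logarithmic
  differentiation in \<open>u\<close> therefore sees only the \<open>sqprod\<close> factors.\<close>

definition cubic_const :: "complex \<Rightarrow> complex" where
  "cubic_const a = (1 - p) * qpochinf a (p^3) * qpochinf (a * p) (p^3)
     / (qpochinf p (p^3) * qpochinf (p\<^sup>2) (p^3))"

text \<open>At \<open>a = p\<close> the series collapses to its first term, so the unknown value at \<open>a = 0\<close>
  can be eliminated.\<close>

lemma cubic_sum_eq:
  assumes "a \<in> dom" "cmod u \<le> rad"
  shows "sqprod a u * cubic_sum a u = cubic_const a * sqprod p u"
proof -
  have nz: "qpochinf p (p^3) \<noteq> 0" "qpochinf (p\<^sup>2) (p^3) \<noteq> 0"
    by (intro qpochinf_nonzero norm_p3 norm_p norm_p2)+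
  have "sqprod p u * (1 - p) = qpochinf p (p^3) * qpochinf (p\<^sup>2) (p^3) * cubic_sum 0 u"
    using cubic_sum_sqprod[OF p_in_dom assms(2)] by (simp add: cubic_sum_p power2_eq_square)
  hence "cubic_sum 0 u = sqprod p u * (1 - p) / (qpochinf p (p^3) * qpochinf (p\<^sup>2) (p^3))"
    using nz by (simp add: field_simps)
  thus ?thesis using cubic_sum_sqprod[OF assms] by (simp add: cubic_const_def)
qed

text \<open>At \<open>u = 0\<close> the closed form contains squares of \<open>e1\<close> and
  \<open>e2\<close>. Trisecting \<open>qpochinf a p\<close> and \<open>qpochinf p p\<close> trades
  \<open>A1\<close> and \<open>A2\<close> for products to base \<open>p\<close> and raises these
  squares to cubes.\<close>

lemma cubic_sum_0:
  assumes "a \<in> dom"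
  shows "cubic_sum a 0 = qpochinf a p * (qpochinf (p^3) (p^3))^3
           / (qpochinf (p\<^sup>2) p * (qpochinf (a * p\<^sup>2) (p^3))^3)"
proof -
  define e1 where "e1 = qpochinf (a * p\<^sup>2) (p^3)"
  define e2 where "e2 = qpochinf (p^3) (p^3)"
  define A1 where "A1 = qpochinf a (p^3) * qpochinf (a * p) (p^3)"
  define A2 where "A2 = qpochinf p (p^3) * qpochinf (p\<^sup>2) (p^3)"
  have p3: "p * p\<^sup>2 = p^3" by (simp add: power2_eq_square power3_eq_cube)
  have e1: "e1 \<noteq> 0" unfolding e1_def by (rule qpochinf_dom_nonzero[OF assms])
  have e2: "e2 \<noteq> 0" unfolding e2_def by (intro qpochinf_nonzero norm_p3)
  have A2: "A2 \<noteq> 0" unfolding A2_def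
    by (intro no_zero_divisors qpochinf_nonzero norm_p3 norm_p norm_p2)
  have ta: "qpochinf a p = A1 * e1"
    unfolding A1_def e1_def by (rule qpochinf_trisect[OF norm_p])
  have "qpochinf p p = A2 * e2"
    unfolding A2_def e2_def using qpochinf_trisect[OF norm_p, of p] p3 by (simp add: power2_eq_square)
  hence tp: "(1 - p) * qpochinf (p\<^sup>2) p = A2 * e2"
    using qpochinf_shift[OF norm_p, of p] by (simp add: power2_eq_square)
  have "1 - p \<noteq> 0" using power_p_neq_1[of 1] by simp
  hence tp': "qpochinf (p\<^sup>2) p = A2 * e2 / (1 - p)" using tp by (simp add: field_simps)
  have "e1\<^sup>2 * cubic_sum a 0 = (1 - p) * A1 / A2 * e2\<^sup>2"
    using cubic_sum_eq[OF assms, of 0] rad_pos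
    by (simp add: sqprod_0 assms p_in_dom p3 cubic_const_def e1_def e2_def A1_def A2_def mult.assoc)
  hence "cubic_sum a 0 = (1 - p) * A1 / A2 * e2\<^sup>2 / e1\<^sup>2"
    using e1 by (metis nonzero_mult_div_cancel_left power_not_zero)
  also have "\<dots> = (A1 * e1) * e2^3 / (A2 * e2 / (1 - p) * e1^3)"
    using e1 e2 A2 \<open>1 - p \<noteq> 0\<close> by (simp add: divide_simps) (simp add: eval_nat_numeral)
  finally show ?thesis unfolding ta tp' e1_def e2_def .
qed

section \<open>Differentiation at the undeformed point\<close>

text \<open>Minus the logarithmic derivative of \<open>sqprod a\<close> at \<open>u = 0\<close>: a
  factor \<open>sqfac y u\<close> contributes \<open>- y / (1 - y)^2\<close> to that
  derivative.\<close>

definition log_deriv :: "complex \<Rightarrow> complex" where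
  "log_deriv a = (\<Sum>m. a * p ^ (3*m+2) / (1 - a * p ^ (3*m+2))\<^sup>2)"

text \<open>The partial products are holomorphic and converge uniformly, so their derivatives
  converge to the derivative of the limit.\<close>

lemma sqprod_deriv:
  assumes "a \<in> dom"
  shows "(\<lambda>m. a * p ^ (3*m+2) / (1 - a * p ^ (3*m+2))\<^sup>2) sums log_deriv a"
    and "(sqprod a has_field_derivative - sqprod a 0 * log_deriv a) (at 0)"
proof -
  let ?P = "\<lambda>n u. \<Prod>m<n. sqfac (a * p ^ (3*m+2)) u"
  let ?s = "\<lambda>m. a * p ^ (3*m+2) / (1 - a * p ^ (3*m+2))\<^sup>2"
  have "?P n holomorphic_on UNIV" for n by (intro holomorphic_intros)
  hence "\<forall>\<^sub>F n in sequentially. continuous_on (cball 0 rad) (?P n)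
          \<and> (\<forall>w\<in>ball 0 rad. (?P n has_field_derivative deriv (?P n) w) (at w))"
    by (intro always_eventually allI conjI ballI continuous_intros)
       (auto intro: holomorphic_derivI)
  from has_complex_derivative_uniform_limit[OF this sqprod_uniform_limit[OF assms] _ rad_pos]
  obtain g' where g': "\<And>w. w \<in> ball 0 rad \<Longrightarrow> (sqprod a has_field_derivative g' w) (at w)
      \<and> (\<lambda>n. deriv (?P n) w) \<longlonglongrightarrow> g' w" by auto
  have D: "(sqprod a has_field_derivative g' 0) (at 0)" and L: "(\<lambda>n. deriv (?P n) 0) \<longlonglongrightarrow> g' 0"
    using g'[of 0] rad_pos by auto
  have nz: "sqfac (a * p ^ (3*m+2)) 0 \<noteq> 0" for m
    using sqfac_dom_nonzero[OF assms, of 0 m] rad_pos by simp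
  have "(?P n has_field_derivative ?P n 0 * (\<Sum>m<n. - (a * p ^ (3*m+2)) / sqfac (a * p ^ (3*m+2)) 0)) (at 0)" for n
    by (rule has_field_derivative_prod') (use nz in \<open>auto intro: derivative_intros simp del: sqfac_0\<close>)
  hence "deriv (?P n) 0 = ?P n 0 * (\<Sum>m<n. - (a * p ^ (3*m+2)) / sqfac (a * p ^ (3*m+2)) 0)" for n
    by (rule DERIV_imp_deriv)
  also have "?P n 0 * (\<Sum>m<n. - (a * p ^ (3*m+2)) / sqfac (a * p ^ (3*m+2)) 0) = - ?P n 0 * (\<Sum>m<n. ?s m)" for n
    by (simp add: sum_negf)
  finally have dP: "deriv (?P n) 0 = - ?P n 0 * (\<Sum>m<n. ?s m)" for n .
  have P0: "(\<lambda>n. ?P n 0) \<longlonglongrightarrow> sqprod a 0" using rad_pos by (intro sqprod_LIMSEQ assms) auto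
  have s0: "sqprod a 0 \<noteq> 0" unfolding sqprod_0[OF assms] using qpochinf_dom_nonzero[OF assms] by simp
  have Pn: "?P n 0 \<noteq> 0" for n using nz by (subst prod_zero_iff) auto
  \<comment> \<open>The negated logarithmic derivatives of the partial products are the partial sums
    of \<open>log_deriv a\<close>, whose convergence thus needs no separate estimate.\<close>
  have "(\<lambda>n. - deriv (?P n) 0 / ?P n 0) \<longlonglongrightarrow> - g' 0 / sqprod a 0"
    by (intro tendsto_intros L P0 s0)
  also have "(\<lambda>n. - deriv (?P n) 0 / ?P n 0) = (\<lambda>n. \<Sum>m<n. ?s m)"
    unfolding dP using Pn by (auto simp del: sqfac_0)
  finally have S: "?s sums (- g' 0 / sqprod a 0)" by (simp add: sums_def)
  thus S': "?s sums log_deriv a" unfolding log_deriv_def by (rule summable_sums[OF sums_summable])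
  have "g' 0 = - sqprod a 0 * log_deriv a"
    using sums_unique2[OF S S', symmetric] s0 by simp
  thus "(sqprod a has_field_derivative - sqprod a 0 * log_deriv a) (at 0)" using D by simp
qed

text \<open>Logarithmic differentiation of the product over \<open>i\<close> creates the inner sum
  of the theorem: denominators contribute with a plus sign, numerators with a minus sign.\<close>

lemma cubic_term_deriv:
  assumes "a \<in> dom"
  shows "((\<lambda>u. cubic_term p a u k) has_field_derivative cubic_term p a 0 k *
     (\<Sum>i<k. a * p ^ (3*i+2) / (1 - a * p ^ (3*i+2))\<^sup>2 - p ^ (i+1) / (1 - p ^ (i+1))\<^sup>2)) (at 0)"
proof -
  define C where "C = p ^ (k\<^sup>2 + k) * (1 - a * p ^ (4*k)) * qpoch (a / p) p (2*k) / qpoch (p\<^sup>2) p (2*k)"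
  let ?f = "\<lambda>i u. sqfac (p ^ (i+1)) u / sqfac (a * p ^ (3*i+2)) u"
  let ?s = "\<lambda>i. a * p ^ (3*i+2) / (1 - a * p ^ (3*i+2))\<^sup>2 - p ^ (i+1) / (1 - p ^ (i+1))\<^sup>2"
  have term_eq: "cubic_term p a u k = C * (\<Prod>i<k. ?f i u)" for u
    by (simp add: cubic_term_def C_def)
  have D: "sqfac (a * p ^ (3*i+2)) 0 \<noteq> 0" for i
    using sqfac_dom_nonzero[OF assms, of 0] rad_pos by simp
  have N: "sqfac (p ^ (i+1)) 0 \<noteq> 0" for i
    using power_p_neq_1[of "i+1"] by (simp del: power_Suc)
  \<comment> \<open>Matches the logarithmic form with the quotient rule for a numerator
    \<open>n\<close> of derivative \<open>- x\<close> and a denominator \<open>d\<close> of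
    derivative \<open>- y\<close>.\<close>
  have quot: "n / d * (y / d - x / n) = (- x * d - n * - y) / (d * d)"
    if "n \<noteq> 0" "d \<noteq> 0" for n d x y :: complex
    using that by (simp add: field_simps)
  have "(?f i has_field_derivative ?f i 0 * (a * p ^ (3*i+2) / sqfac (a * p ^ (3*i+2)) 0
          - p ^ (i+1) / sqfac (p ^ (i+1)) 0)) (at 0)" for i
    unfolding quot[OF N D] by (intro DERIV_divide has_field_derivative_sqfac D)
  hence "(?f i has_field_derivative ?f i 0 * ?s i) (at 0)" for i by simp
  hence "((\<lambda>u. \<Prod>i<k. ?f i u) has_field_derivative
           (\<Prod>i<k. ?f i 0) * (\<Sum>i<k. ?f i 0 * ?s i / ?f i 0)) (at 0)"
    using D N by (intro has_field_derivative_prod') auto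
  also have "(\<Sum>i<k. ?f i 0 * ?s i / ?f i 0) = (\<Sum>i<k. ?s i)"
    using D N by (intro sum.cong refl) (simp del: sqfac_0)
  finally show ?thesis unfolding term_eq mult.assoc by (intro DERIV_cmult)
qed

lemma cubic_term_holomorphic:
  assumes "a \<in> dom"
  shows "(\<lambda>u. cubic_term p a u k) holomorphic_on ball 0 rad"
  unfolding cubic_term_def using sqfac_dom_nonzero[OF assms]
  \<comment> \<open>A vanishing constant denominator would make the term identically 0, since
    division by 0 gives 0.\<close>
  by (cases "qpoch (p\<^sup>2) p (2*k) = 0") (auto intro!: holomorphic_intros)

text \<open>Both sides of \<open>cubic_sum_eq\<close> are differentiated at \<open>u = 0\<close>.
  The product rule gives the derivative of the series as its value times the difference of the two
  \<open>log_deriv\<close>; termwise differentiation gives it as the displayed series.\<close>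

theorem cubic_deriv_sums:
  assumes "a \<in> dom"
  shows "(\<lambda>k. cubic_term p a 0 k *
     (\<Sum>i<k. a * p ^ (3*i+2) / (1 - a * p ^ (3*i+2))\<^sup>2 - p ^ (i+1) / (1 - p ^ (i+1))\<^sup>2))
     sums (cubic_sum a 0 * (log_deriv a - log_deriv p))"
proof -
  let ?s = "\<lambda>k. \<Sum>i<k. a * p ^ (3*i+2) / (1 - a * p ^ (3*i+2))\<^sup>2 - p ^ (i+1) / (1 - p ^ (i+1))\<^sup>2"
  have 0: "0 \<in> ball 0 rad" using rad_pos by simp
  have hd: "((\<lambda>u. cubic_term p a u k) has_field_derivative deriv (\<lambda>u. cubic_term p a u k) w) (at w)"
    if "w \<in> ball 0 rad" for k w
    using holomorphic_derivI[OF cubic_term_holomorphic[OF assms] open_ball that] .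
  have bd: "\<forall>\<^sub>F k in sequentially. \<forall>u\<in>ball 0 rad. cmod (cubic_term p a u k)
      \<le> (cmod p ^ (k\<^sup>2 + k) * ratio_bound ^ k) * (1 + 1 / cmod p)"
    using norm_cubic_term_le[OF assms] by (intro always_eventually) auto
  obtain g g' where G: "\<forall>u\<in>ball 0 rad. (\<lambda>k. cubic_term p a u k) sums g u
      \<and> (\<lambda>k. deriv (\<lambda>u. cubic_term p a u k) u) sums g' u \<and> (g has_field_derivative g' u) (at u)"
    by (rule series_and_derivative_comparison[OF open_ball summable_majorant hd bd])
  hence g: "\<And>u. u \<in> ball 0 rad \<Longrightarrow> (\<lambda>k. cubic_term p a u k) sums g u"
    "\<And>u. u \<in> ball 0 rad \<Longrightarrow> (\<lambda>k. deriv (\<lambda>u. cubic_term p a u k) u) sums g' u"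
    "\<And>u. u \<in> ball 0 rad \<Longrightarrow> (g has_field_derivative g' u) (at u)" by blast+
  have g_eq: "g u = cubic_sum a u" if "u \<in> ball 0 rad" for u
    using sums_unique2[OF g(1)[OF that] cubic_term_sums[OF assms]] that by simp
  have S: "(\<lambda>k. cubic_term p a 0 k * ?s k) sums g' 0"
    using g(2)[OF 0] DERIV_imp_deriv[OF cubic_term_deriv[OF assms]] by simp
  have "\<forall>\<^sub>F u in nhds 0. sqprod a u * g u = cubic_const a * sqprod p u"
    using eventually_nhds_in_open[OF open_ball 0]
    by eventually_elim (use g_eq cubic_sum_eq[OF assms] in auto)
  hence ev: "((\<lambda>u. sqprod a u * g u) has_field_derivative d) (at 0)
      \<longleftrightarrow> ((\<lambda>u. cubic_const a * sqprod p u) has_field_derivative d) (at 0)" for d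
    by (intro DERIV_cong_ev refl)
  have "((\<lambda>u. sqprod a u * g u) has_field_derivative
          (- sqprod a 0 * log_deriv a) * g 0 + g' 0 * sqprod a 0) (at 0)"
    by (rule DERIV_mult[OF sqprod_deriv(2)[OF assms] g(3)[OF 0]])
  moreover have "((\<lambda>u. cubic_const a * sqprod p u) has_field_derivative
          cubic_const a * (- sqprod p 0 * log_deriv p)) (at 0)"
    by (rule DERIV_cmult[OF sqprod_deriv(2)[OF p_in_dom]])
  ultimately have "(- sqprod a 0 * log_deriv a) * g 0 + g' 0 * sqprod a 0
      = cubic_const a * (- sqprod p 0 * log_deriv p)"
    unfolding ev by (rule DERIV_unique)
  also have "\<dots> = - (cubic_const a * sqprod p 0) * log_deriv p" by simp
  also have "cubic_const a * sqprod p 0 = sqprod a 0 * cubic_sum a 0"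
    using cubic_sum_eq[OF assms, of 0] rad_pos by simp
  finally have "sqprod a 0 * g' 0 = sqprod a 0 * (cubic_sum a 0 * (log_deriv a - log_deriv p))"
    unfolding g_eq[OF 0] by (simp add: algebra_simps)
  moreover have "sqprod a 0 \<noteq> 0"
    unfolding sqprod_0[OF assms] using qpochinf_dom_nonzero[OF assms] by simp
  ultimately show ?thesis using S by simp
qed

end

section \<open>Specialization to base \<open>q^2\<close> and parameter \<open>1/q\<close>\<close>

theorem theorem1p6:
  fixes q :: complex
  assumes "0 < cmod q" and "cmod q < 1"
  shows "summable (\<lambda>j. (-1) ^ (j+1) * q ^ (3*(j+1) - 1) / (qint q (3*(j+1)))\<^sup>2) \<and>
    (\<lambda>m. let k = m + 1 in
        q ^ (2*k^2 + 2*k) * qint q (8*k - 1)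
        * (qpoch (q^2) (q^2) k)\<^sup>2 * qpoch (inverse (q^3)) (q^2) (2*k)
        / (qpoch (q^4) (q^2) (2*k) * (qpoch (q^3) (q^6) k)\<^sup>2)
        * (\<Sum>i=1..k. q ^ (6*i - 3) / (qint q (6*i - 3))\<^sup>2 - q ^ (2*i) / (qint q (2*i))\<^sup>2))
    sums (qpochinf q (q^2) * (qpochinf (q^6) (q^6)) ^ 3
          / (qpochinf (q^4) (q^2) * (qpochinf (q^3) (q^6)) ^ 3)
          * (\<Sum>j. (-1) ^ (j+1) * q ^ (3*(j+1) - 1) / (qint q (3*(j+1)))\<^sup>2))"
proof -
  have q0: "q \<noteq> 0" using assms by auto
  have q1: "1 - q \<noteq> 0" using assms by auto
  have pnq: "cmod (q ^ n) < 1" if "n > 0" for n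
    using assms that by (simp add: norm_power power_less_one_iff)
  interpret cubic_base "q\<^sup>2"
    using q0 pnq[of 2] by unfold_locales auto
  define a where "a = 1 / q"
  have a: "a \<in> dom"
  proof -
    have "(cmod q)\<^sup>2 \<le> cmod q" using assms by (simp add: power2_eq_square mult_le_cancel_left1)
    hence "cmod a \<le> 1 / cmod (q\<^sup>2)"
      using assms by (simp add: a_def norm_divide norm_power frac_le)
    thus ?thesis unfolding dom_def by simp
  qed
  have ap: "a * (q\<^sup>2) ^ (3*m+2) = q ^ (6*m+3)" for m
  proof -
    have "(q\<^sup>2) ^ (3*m+2) = q * q ^ (6*m+3)"
      unfolding power_mult[symmetric] power_Suc[symmetric] by (rule arg_cong[where f="power q"]) simp
    thus ?thesis using q0 by (simp add: a_def)
  qed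
  have pp: "q\<^sup>2 * (q\<^sup>2) ^ (3*m+2) = q ^ (6*m+6)" for m
    unfolding power_mult[symmetric] power_add[symmetric] by (rule arg_cong[where f="power q"]) simp
  have ap2: "a * q^4 = q^3" using q0 by (simp add: a_def eval_nat_numeral)
  have powers: "(q\<^sup>2)^3 = q^6" "(q\<^sup>2)\<^sup>2 = q^4" by (simp_all flip: power_mult)

  \<comment> \<open>The terms of the right-hand series without sign and normalization. Even indices
    have exponents \<open>6*m+3\<close> and make up \<open>log_deriv a\<close>; odd ones have
    \<open>6*m+6\<close> and make up \<open>log_deriv (q^2)\<close>.\<close>
  define g where "g = (\<lambda>j. q ^ (3*(j+1)) / (1 - q ^ (3*(j+1)))\<^sup>2)"
  have La: "(\<lambda>m. g (2*m)) sums log_deriv a"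
  proof -
    have "g (2*m) = a * (q\<^sup>2) ^ (3*m+2) / (1 - a * (q\<^sup>2) ^ (3*m+2))\<^sup>2" for m
      unfolding ap g_def by (simp add: algebra_simps)
    thus ?thesis using sqprod_deriv(1)[OF a] by simp
  qed
  have Lp: "(\<lambda>m. g (2*m+1)) sums log_deriv (q\<^sup>2)"
  proof -
    have "g (2*m+1) = q\<^sup>2 * (q\<^sup>2) ^ (3*m+2) / (1 - q\<^sup>2 * (q\<^sup>2) ^ (3*m+2))\<^sup>2" for m
      unfolding pp g_def by (simp add: algebra_simps)
    thus ?thesis using sqprod_deriv(1)[OF p_in_dom] by simp
  qed
  have g_le: "cmod (g j) \<le> cmod q ^ j * (1 / (1 - cmod q)\<^sup>2)" for j
  proof -
    have le: "cmod q ^ (3*(j+1)) \<le> cmod q ^ n" if "n \<le> 3*(j+1)" for n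
      using that assms by (intro power_decreasing) auto
    have "1 - cmod q \<le> cmod (1 - q ^ (3*(j+1)))"
      using norm_triangle_ineq2[of 1 "q ^ (3*(j+1))"] le[of 1] by (simp add: norm_power)
    hence "(1 - cmod q)\<^sup>2 \<le> cmod ((1 - q ^ (3*(j+1)))\<^sup>2)"
      unfolding norm_power using assms by (intro power_mono) auto
    hence "cmod (g j) \<le> cmod q ^ j / (1 - cmod q)\<^sup>2"
      unfolding g_def norm_divide using le[of j] assms
      by (intro frac_le) (auto simp: norm_power)
    thus ?thesis by simp
  qed
  \<comment> \<open>Convergence of the ungrouped alternating series comes first; only then may its
    terms be grouped in pairs.\<close>
  have sm: "summable (\<lambda>j. (-1) ^ (j+1) * g j)"
  proof (rule summable_comparison_test)
    show "\<exists>N. \<forall>n\<ge>N. norm ((-1) ^ (n+1) * g n) \<le> cmod q ^ n * (1 / (1 - cmod q)\<^sup>2)"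
      using g_le by (simp add: norm_mult norm_power)
    show "summable (\<lambda>n. cmod q ^ n * (1 / (1 - cmod q)\<^sup>2))"
      using assms by (intro summable_mult2 summable_geometric) auto
  qed
  have alt: "(\<lambda>j. (-1) ^ (j+1) * g j) sums (log_deriv (q\<^sup>2) - log_deriv a)"
  proof -
    have "(\<lambda>n. sum (\<lambda>j. (-1) ^ (j+1) * g j) {n*2..<n*2+2}) sums (\<Sum>j. (-1) ^ (j+1) * g j)"
      using sums_group[OF summable_sums[OF sm], of 2] by simp
    moreover have "sum (\<lambda>j. (-1) ^ (j+1) * g j) {n*2..<n*2+2} = g (2*n+1) - g (2*n)" for n
    proof -
      have "{n*2..<n*2+2} = {2*n, 2*n+1}" by auto
      thus ?thesis by simp
    qed
    ultimately have "(\<lambda>n. g (2*n+1) - g (2*n)) sums (\<Sum>j. (-1) ^ (j+1) * g j)" by simp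
    hence "(\<Sum>j. (-1) ^ (j+1) * g j) = log_deriv (q\<^sup>2) - log_deriv a"
      using sums_unique2[OF _ sums_diff[OF Lp La]] by blast
    thus ?thesis using summable_sums[OF sm] by simp
  qed
  \<comment> \<open>The squared q-integer yields \<open>(1 - q)^2\<close>, and the exponent, one
    less than that in \<open>g\<close>, yields \<open>1 / q\<close>.\<close>
  have rhs: "(-1) ^ (j+1) * q ^ (3*(j+1) - 1) / (qint q (3*(j+1)))\<^sup>2
      = (1 - q)\<^sup>2 / q * ((-1) ^ (j+1) * g j)" for j
  proof -
    have "q ^ (3*(j+1)) = q * q ^ (3*(j+1) - 1)"
      unfolding power_Suc[symmetric] by (rule arg_cong[where f="power q"]) simp
    thus ?thesis using q0 unfolding qint_def g_def power_divide by (simp del: power_Suc)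
  qed
  have R: "(\<lambda>j. (-1) ^ (j+1) * q ^ (3*(j+1) - 1) / (qint q (3*(j+1)))\<^sup>2)
      sums ((1 - q)\<^sup>2 / q * (log_deriv (q\<^sup>2) - log_deriv a))"
    unfolding rhs by (intro sums_mult alt)

  define s where "s = (\<lambda>k. \<Sum>i<k. a * (q\<^sup>2) ^ (3*i+2) / (1 - a * (q\<^sup>2) ^ (3*i+2))\<^sup>2
                              - (q\<^sup>2) ^ (i+1) / (1 - (q\<^sup>2) ^ (i+1))\<^sup>2)"
  have inner: "(\<Sum>i=1..k. q ^ (6*i - 3) / (qint q (6*i - 3))\<^sup>2 - q ^ (2*i) / (qint q (2*i))\<^sup>2)
      = (1 - q)\<^sup>2 * s k" for k
  proof -
    have "(\<Sum>i=1..k. q ^ (6*i - 3) / (qint q (6*i - 3))\<^sup>2 - q ^ (2*i) / (qint q (2*i))\<^sup>2)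
        = (\<Sum>i<k. q ^ (6*(i+1) - 3) / (qint q (6*(i+1) - 3))\<^sup>2 - q ^ (2*(i+1)) / (qint q (2*(i+1)))\<^sup>2)"
      by (rule sum.reindex_bij_witness[of _ "\<lambda>i. i+1" "\<lambda>i. i-1"]) auto
    also have "\<dots> = (1 - q)\<^sup>2 * s k"
      unfolding s_def sum_distrib_left
    proof (rule sum.cong[OF refl])
      fix i :: nat
      have e: "6*(i+1) - 3 = 6*i+(3::nat)" by simp
      show "q ^ (6*(i+1) - 3) / (qint q (6*(i+1) - 3))\<^sup>2 - q ^ (2*(i+1)) / (qint q (2*(i+1)))\<^sup>2
        = (1 - q)\<^sup>2 * (a * (q\<^sup>2) ^ (3*i+2) / (1 - a * (q\<^sup>2) ^ (3*i+2))\<^sup>2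
            - (q\<^sup>2) ^ (i+1) / (1 - (q\<^sup>2) ^ (i+1))\<^sup>2)"
        unfolding e ap qint_def power_mult[of q 2] power_divide
        by (simp add: right_diff_distrib mult.commute del: power_Suc)
    qed
    finally show ?thesis .
  qed
  \<comment> \<open>The restriction to \<open>k > 0\<close> makes \<open>8*k - 1\<close> a genuine
    difference of naturals.\<close>
  have outer: "q ^ (2*k^2 + 2*k) * qint q (8*k - 1)
        * (qpoch (q^2) (q^2) k)\<^sup>2 * qpoch (inverse (q^3)) (q^2) (2*k)
        / (qpoch (q^4) (q^2) (2*k) * (qpoch (q^3) (q^6) k)\<^sup>2)
      = cubic_term (q\<^sup>2) a 0 k / (1 - q)" if "k > 0" for k
  proof -
    have "(q\<^sup>2) ^ (4*k) = q * q ^ (8*k - 1)"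
      unfolding power_mult[symmetric] power_Suc[symmetric] using that
      by (intro arg_cong[where f="power q"]) simp
    hence 1: "a * (q\<^sup>2) ^ (4*k) = q ^ (8*k - 1)" using q0 by (simp add: a_def)
    have 2: "a / q\<^sup>2 = inverse (q^3)"
      by (simp add: a_def field_simps power2_eq_square power3_eq_cube)
    have 3: "(q\<^sup>2) ^ (k\<^sup>2 + k) = q ^ (2*k\<^sup>2 + 2*k)"
      unfolding power_mult[symmetric] by (rule arg_cong[where f="power q"]) simp
    have N: "(\<Prod>i<k. sqfac ((q\<^sup>2) ^ (i+1)) 0) = (qpoch (q^2) (q^2) k)\<^sup>2"
      by (simp add: qpoch_def prod_power_distrib)
    have D: "(\<Prod>i<k. sqfac (a * (q\<^sup>2) ^ (3*i+2)) 0) = (qpoch (q^3) (q^6) k)\<^sup>2"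
    proof -
      have "q ^ (6*i+3) = q^3 * (q^6) ^ i" for i
        unfolding power_add power_mult by (simp only: mult_ac)
      thus ?thesis unfolding ap by (simp only: qpoch_def prod_power_distrib sqfac_0)
    qed
    show ?thesis
      unfolding cubic_term_def prod_dividef N D 1 2 3 powers qint_def by (simp add: mult_ac)
  qed
  have L: "(\<lambda>k. (1 - q) * (cubic_term (q\<^sup>2) a 0 k * s k))
      sums ((1 - q) * (cubic_sum a 0 * (log_deriv a - log_deriv (q\<^sup>2))))"
    unfolding s_def by (intro sums_mult cubic_deriv_sums a)
  have lhs: "q ^ (2*k^2 + 2*k) * qint q (8*k - 1)
        * (qpoch (q^2) (q^2) k)\<^sup>2 * qpoch (inverse (q^3)) (q^2) (2*k)
        / (qpoch (q^4) (q^2) (2*k) * (qpoch (q^3) (q^6) k)\<^sup>2)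
        * (\<Sum>i=1..k. q ^ (6*i - 3) / (qint q (6*i - 3))\<^sup>2 - q ^ (2*i) / (qint q (2*i))\<^sup>2)
      = (1 - q) * (cubic_term (q\<^sup>2) a 0 k * s k)" if "k > 0" for k
    unfolding outer[OF that] inner using q1 by (simp add: power2_eq_square)
  \<comment> \<open>The term \<open>k = 0\<close> contains an empty inner sum, so starting at
    \<open>k = 1\<close> leaves the value unchanged.\<close>
  have L': "(\<lambda>m. (1 - q) * (cubic_term (q\<^sup>2) a 0 (m+1) * s (m+1)))
      sums ((1 - q) * (cubic_sum a 0 * (log_deriv a - log_deriv (q\<^sup>2))))"
    using sums_Suc_iff[of "\<lambda>k. (1 - q) * (cubic_term (q\<^sup>2) a 0 k * s k)"] L
    by (simp add: s_def)

  define Q where "Q = qpochinf q (q^2) * (qpochinf (q^6) (q^6)) ^ 3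
          / (qpochinf (q^4) (q^2) * (qpochinf (q^3) (q^6)) ^ 3)"
  \<comment> \<open>Splitting off the first factor \<open>1 - 1/q\<close> leaves the product
    starting at \<open>q\<close>. Its value \<open>- (1 - q) / q\<close> supplies the factor
    \<open>1 / q\<close> and the sign that reverses the difference of the two
    \<open>log_deriv\<close>.\<close>
  have "qpochinf a (q\<^sup>2) = (1 - a) * qpochinf q (q\<^sup>2)"
    using qpochinf_shift[OF norm_p, of a] q0 by (simp add: a_def power2_eq_square)
  hence S: "cubic_sum a 0 = (1 - a) * Q"
    using cubic_sum_0[OF a] unfolding ap2 powers Q_def by (simp add: mult.assoc)
  have a1: "1 - a = - ((1 - q) / q)" using q0 by (simp add: a_def field_simps)
  have "c * (- (c / q) * Q * (x - y)) = Q * (c\<^sup>2 / q * (y - x))" for c x y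
    using q0 by (simp add: field_simps power2_eq_square)
  hence "(1 - q) * (cubic_sum a 0 * (log_deriv a - log_deriv (q\<^sup>2)))
      = Q * ((1 - q)\<^sup>2 / q * (log_deriv (q\<^sup>2) - log_deriv a))"
    unfolding S a1 .
  hence "(\<lambda>m. (1 - q) * (cubic_term (q\<^sup>2) a 0 (m+1) * s (m+1)))
      sums (Q * (\<Sum>j. (-1) ^ (j+1) * q ^ (3*(j+1) - 1) / (qint q (3*(j+1)))\<^sup>2))"
    using L' sums_unique[OF R] by (simp only:)
  moreover have "m + 1 > 0" for m :: nat by simp
  ultimately show ?thesis
    using sums_summable[OF R] unfolding Let_def Q_def by (simp only: lhs)
qed

end
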